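(* Let $\mathcal U$ be a complex Banach space, $\Psi=(\psi,s)$ an (arbitrary) evolution in $\mathcal U$, and let $X,Y,Z$ be observables on $\Psi$, each taking values in $\{-1,+1\}$, that are jointly observable on $\Psi$. Then $$|E_t(XY)-E_t(YZ)|\le 1-E_t(XZ)\qquad\text{for all } t\ge0,$$ where $E_t(XY)$ (and likewise $E_t(YZ)$, $E_t(XZ)$) is the expected value of the product variable $X_tY_t$ at time $t$ with respect to the joint distribution.
   Context: An evolution $\Psi=(\psi,s)$ in $\mathcal U$ consists of a linear operator $\psi$ on $\mathcal U$ and a vector $s\in\mathcal U$; its states are $s^{(t)}=\psi^ts$, $t\ge0$. An observable on $\Psi$ with finite or countable range $A$ is a collection $\{\chi_a\mid a\in A\}$ of continuous linear functionals on $\mathcal U$ such that, for every $t\ge0$, the numbers $p_a^{(t)}=\chi_a(s^{(t)})$ are real and nonnegative with $\sum_{a\in A}p_a^{(t)}=1$; one writes $\Pr\{X_t=a\}=p_a^{(t)}$. Observables $X^{(1)},\dots,X^{(k)}$ on $\Psi$ with ranges $A_1,\dots,A_k$ are jointly observable on $\Psi$ if there is an observable $W$ on $\Psi$ with range $A_1\times\dots\times A_k$ such that each $X^{(j)}$ is the $j$th marginal of $W$: for all $j$, $a\in A_j$, $t\ge0$, $\Pr\{X^{(j)}_t=a\}=\sum\Pr\{W_t=(a_1,\dots,a_k)\}$, the sum over all $(a_1,\dots,a_k)\in A_1\times\dots\times A_k$ with $a_j=a$. For three jointly observable $X,Y,Z$ with joint observable $W$, put $p_t(x,y,z)=\Pr\{W_t=(x,y,z)\}$;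 then $E_t(XY)=\sum_{x,y,z}xy\,p_t(x,y,z)$, and similarly for $E_t(YZ)$ and $E_t(XZ)$. *)

theory Defs
  imports "HOL-Analysis.Analysis"
begin

text \<open>
  The axioms of a complex Banach space that are not already those of \<open>banach\<close>:
  the complex scalar multiplication extends the real one, and the norm is
  homogeneous with respect to complex scalars.
\<close>

class complex_banach = banach +
  fixes scaleC :: "complex \<Rightarrow> 'a \<Rightarrow> 'a" (infixr "*\<^sub>C" 75)
  assumes scaleC_add_right: "c *\<^sub>C (x + y) = c *\<^sub>C x + c *\<^sub>C y"
    and scaleC_add_left: "(c + d) *\<^sub>C x = c *\<^sub>C x + d *\<^sub>C x"
    and scaleC_scaleC: "c *\<^sub>C (d *\<^sub>C x) = (c * d) *\<^sub>C x"
    and scaleC_one: "1 *\<^sub>C x = x"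
    and scaleR_scaleC: "r *\<^sub>R x = complex_of_real r *\<^sub>C x"
    and norm_scaleC: "norm (c *\<^sub>C x) = cmod c * norm x"

lemma vector_space_scaleC:
  "vector_space (scaleC :: complex \<Rightarrow> 'u \<Rightarrow> 'u::complex_banach)"
  by (rule vector_space.intro)
     (simp_all add: scaleC_add_right scaleC_add_left scaleC_scaleC scaleC_one)

instantiation complex :: complex_banach
begin

definition scaleC_complex :: "complex \<Rightarrow> complex \<Rightarrow> complex"
  where "scaleC_complex c x = c * x"

instance
  by standard (simp_all add: scaleC_complex_def algebra_simps norm_mult scaleR_conv_of_real)

end

text \<open>
  An evolution is a pair of a linear operator and an initial vector.  The operator
  is not required to be bounded.
\<close>

type_synonym 'u evol = "('u \<Rightarrow> 'u) \<times> 'u"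

definition evolution :: "'u::complex_banach evol \<Rightarrow> bool"
  where "evolution \<Psi> \<longleftrightarrow> Vector_Spaces.linear scaleC scaleC (fst \<Psi>)"

definition state :: "'u evol \<Rightarrow> nat \<Rightarrow> 'u"
  where "state \<Psi> t = (fst \<Psi> ^^ t) (snd \<Psi>)"

text \<open>
  An observable is a family \<open>X\<close> of functionals, relevant only for indices in its range \<open>A\<close>.
  The sum over the countable range is unconditional, which for nonnegative terms agrees
  with summation along any enumeration.
\<close>

definition observable ::
  "'u::complex_banach evol \<Rightarrow> 'a set \<Rightarrow> ('a \<Rightarrow> 'u \<Rightarrow> complex) \<Rightarrow> bool"
  where "observable \<Psi> A X \<longleftrightarrow>
    countable A \<and>
    (\<forall>a\<in>A. Vector_Spaces.linear scaleC (*) (X a) \<and> continuous_on UNIV (X a)) \<and>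
    (\<forall>t. (\<forall>a\<in>A. X a (state \<Psi> t) \<in> \<real> \<and> 0 \<le> Re (X a (state \<Psi> t))) \<and>
         ((\<lambda>a. X a (state \<Psi> t)) has_sum 1) A)"

text \<open>\<open>Pr\<close> is the real number \<open>X a (state \<Psi> t)\<close>; the imaginary part vanishes for observables.\<close>

definition Pr :: "'u evol \<Rightarrow> ('a \<Rightarrow> 'u \<Rightarrow> complex) \<Rightarrow> nat \<Rightarrow> 'a \<Rightarrow> real"
  where "Pr \<Psi> X t a = Re (X a (state \<Psi> t))"

definition joint_observable ::
  "'u::complex_banach evol \<Rightarrow> 'a set \<Rightarrow> ('a \<Rightarrow> 'u \<Rightarrow> complex) \<Rightarrow>
    'b set \<Rightarrow> ('b \<Rightarrow> 'u \<Rightarrow> complex) \<Rightarrow> 'c set \<Rightarrow> ('c \<Rightarrow> 'u \<Rightarrow> complex) \<Rightarrow>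
    ('a \<times> 'b \<times> 'c \<Rightarrow> 'u \<Rightarrow> complex) \<Rightarrow> bool"
  where "joint_observable \<Psi> A X B Y C Z W \<longleftrightarrow>
    observable \<Psi> (A \<times> B \<times> C) W \<and>
    (\<forall>t. \<forall>a\<in>A. (Pr \<Psi> W t has_sum Pr \<Psi> X t a) {(x, y, z) \<in> A \<times> B \<times> C. x = a}) \<and>
    (\<forall>t. \<forall>b\<in>B. (Pr \<Psi> W t has_sum Pr \<Psi> Y t b) {(x, y, z) \<in> A \<times> B \<times> C. y = b}) \<and>
    (\<forall>t. \<forall>c\<in>C. (Pr \<Psi> W t has_sum Pr \<Psi> Z t c) {(x, y, z) \<in> A \<times> B \<times> C. z = c})"

definition expect ::
  "'u evol \<Rightarrow> 'w set \<Rightarrow> ('w \<Rightarrow> 'u \<Rightarrow> complex) \<Rightarrow> nat \<Rightarrow> ('w \<Rightarrow> real) \<Rightarrow> real"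
  where "expect \<Psi> S W t f = (\<Sum>\<^sub>\<infinity>w\<in>S. f w * Pr \<Psi> W t w)"

end

theory Submission
  imports Defs
begin

text \<open>At a fixed time t the numbers \<open>Pr \<Psi> W t w\<close> form an ordinary
  probability distribution on the eight sign triples (\<open>observable_Pr_nonneg\<close>,
  \<open>observable_Pr_has_sum\<close>), so the claim reduces to Bell's classical argument. For
  signs x, y, z one has |xy - yz| = |y| |x - z| = |x - z| = 1 - xz; averaging this identity and
  moving the absolute value inside the sum gives the inequality.\<close>

lemma
  assumes "observable \<Psi> A X"
  shows observable_Pr_nonneg: "a \<in> A \<Longrightarrow> 0 \<le> Pr \<Psi> X t a"
    and observable_Pr_has_sum: "(Pr \<Psi> X t has_sum 1) A"
proof -
  have "((\<lambda>a. X a (state \<Psi> t)) has_sum 1) A"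
    using assms by (simp add: observable_def)
  from has_sum_Re[OF this] show "(Pr \<Psi> X t has_sum 1) A"
    by (simp add: Pr_def[abs_def])
qed (use assms in \<open>auto simp: observable_def Pr_def\<close>)

lemma expect_finite: "finite S \<Longrightarrow> expect \<Psi> S W t f = (\<Sum>w\<in>S. f w * Pr \<Psi> W t w)"
  by (simp add: expect_def)

theorem lemma2:
  fixes \<Psi> :: "'u::complex_banach evol"
    and X Y Z :: "real \<Rightarrow> 'u \<Rightarrow> complex"
    and W :: "real \<times> real \<times> real \<Rightarrow> 'u \<Rightarrow> complex"
    and t :: nat
  defines "R \<equiv> {-1, 1} \<times> {-1, 1} \<times> {-1, 1}"
  assumes "evolution \<Psi>"
    and "observable \<Psi> {-1, 1} X"
    and "observable \<Psi> {-1, 1} Y"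
    and "observable \<Psi> {-1, 1} Z"
    and "joint_observable \<Psi> {-1, 1} X {-1, 1} Y {-1, 1} Z W"
  shows "\<bar>expect \<Psi> R W t (\<lambda>(x, y, z). x * y) - expect \<Psi> R W t (\<lambda>(x, y, z). y * z)\<bar>
    \<le> 1 - expect \<Psi> R W t (\<lambda>(x, y, z). x * z)"
proof -
  let ?p = "Pr \<Psi> W t"
  have obs: "observable \<Psi> R W"
    using assms by (simp add: joint_observable_def)
  have fin: "finite R"
    by (simp add: R_def)
  have total: "(\<Sum>w\<in>R. ?p w) = 1"
    using observable_Pr_has_sum[OF obs, of t] fin by (simp add: has_sum_finite_iff)
  have "\<bar>expect \<Psi> R W t (\<lambda>(x, y, z). x * y) - expect \<Psi> R W t (\<lambda>(x, y, z). y * z)\<bar>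
      = \<bar>\<Sum>w\<in>R. (case w of (x, y, z) \<Rightarrow> x * y - y * z) * ?p w\<bar>"
    by (simp add: expect_finite[OF fin] sum_subtractf[symmetric] left_diff_distrib case_prod_unfold)
  also have "\<dots> \<le> (\<Sum>w\<in>R. \<bar>(case w of (x, y, z) \<Rightarrow> x * y - y * z) * ?p w\<bar>)"
    by (rule sum_abs)
  \<comment> \<open>Termwise equality on the eight triples: both factors are 0 if x = z and 2 if x =
    -z, and nonnegativity of the probabilities removes their absolute value.\<close>
  also have "\<dots> = (\<Sum>w\<in>R. (case w of (x, y, z) \<Rightarrow> 1 - x * z) * ?p w)"
    by (rule sum.cong) (auto simp: R_def abs_mult observable_Pr_nonneg[OF obs])
  \<comment> \<open>The constant 1 averages to itself because the total mass is 1.\<close>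
  also have "\<dots> = 1 - expect \<Psi> R W t (\<lambda>(x, y, z). x * z)"
    by (simp add: expect_finite[OF fin] total sum_subtractf left_diff_distrib case_prod_unfold)
  finally show ?thesis .
qed

end
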